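(* Let $J=[a_J,b_J]\subset[0,\pi]$ be a local interval, let $n\ge 2$ be the number of local Fourier modes, let $\mathcal C_J$ be the exact finite-dimensional indicator (formed from the exact coefficient vector $\mathbf z_J$) and $\mathcal C_J^\delta$ the indicator formed from the regularized coefficient vector $\mathbf z_J^\delta$. Let $U\subset J$ be an interval containing one breakpoint $\xi$, and let $\xi_J^\ast\in U$ be an interior local maximizer of $s\,\mathcal C_J$, with $s\in\{-1,1\}$. Assume that for some constant $\kappa_J$ $$(s\,\mathcal C_J)'(\xi_J^\ast)=0,\qquad -(s\,\mathcal C_J)''(x)\ge \kappa_J>0,\qquad x\in U.$$ If $\widehat\xi$ is an interior local maximizer of $s\,\mathcal C_J^\delta$ in $U$, then $$|\widehat\xi-\xi_J^\ast|\le \frac{1}{\kappa_J}\left\|(\mathcal C_J^\delta-\mathcal C_J)'\right\|_{L^\infty(U)} .$$ Moreover, $$\left\|(\mathcal C_J^\delta-\mathcal C_J)'\right\|_{L^\infty(U)}\le C_{J,n,\sigma}\,\|\mathbf z_J^\delta-\mathbf z_J\|_2,\qquad C_{J,n,\sigma}=\mu_J^3\left(\sum_{\ell=1}^{n}\ell^8\,\widehat\sigma_{\lambda_n}(\ell)^2\right)^{1/2}.$$ Consequently, $$|\widehat\xi-\xi|\le \frac{C_{J,n,\sigma}}{\kappa_J}\,\|\mathbf z_J^\delta-\mathbf z_J\|_2+|\xi_J^\ast-\xi| .$$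
   Context: Setting: $g$ is an observed function on $[0,\pi]$, $q=-g''$ is piecewise smooth, and a breakpoint is an interior point of $(0,\pi)$ separating two smooth branches of $q$. Fix $T_{\rm det}>1$. For an interval $J=[a_J,b_J]$ put $$\mu_J=\frac{2\pi}{T_{\rm det}(b_J-a_J)},\qquad t_J(x)=\mu_J(x-a_J).$$ Indicator. A coefficient vector is $\mathbf z=(a_1,\dots,a_n,b_1,\dots,b_n)^{\mathrm T}\in\mathbb R^{2n}$ and represents, up to a constant term $a_0$, the local approximation $a_0+\sum_{\ell=1}^n[a_\ell\cos(\ell t_J(x))+b_\ell\sin(\ell t_J(x))]$ of $g$ on $J$. The corresponding coefficients of the approximation of $q=-g''$ are $a_\ell^{(q)}=(\mu_J\ell)^2a_\ell$ and $b_\ell^{(q)}=(\mu_J\ell)^2b_\ell$. The indicator (mollified conjugate Fourier sum) associated with $\mathbf z$ is $$\mathcal C(x)=\sum_{\ell=1}^{n}\ell\,\widehat\sigma_{\lambda_n}(\ell)\left[b_\ell^{(q)}\cos(\ell t_J(x))-a_\ell^{(q)}\sin(\ell t_J(x))\right],\qquad x\in J,$$ where $$\lambda_n=\frac{n}{\sqrt{\log n}},\qquad \widehat\sigma_{\lambda_n}(\ell)=\frac{1}{\sqrt\pi\,\lambda_n}\exp\left[-\left(\frac{\ell}{\lambda_n}\right)^2\right].$$ $\mathcal C_J$ and $\mathcal C_J^\delta$ denote the indicators associated with $\mathbf z_J$ and $\mathbf z_J^\delta$ respectively. Coefficient vectors. Let $\mathbf g_J^\delta\in\mathbb R^m$ be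 the vector of noisy samples of $g$ at $m$ equally spaced nodes of $J$, with mapped nodes $t_1,\dots,t_m$. Let $A\in\mathbb R^{m\times 2n}$ have rows $(\cos t_r,\dots,\cos nt_r,\sin t_r,\dots,\sin nt_r)$, let $P=I-\frac1m\mathbf 1\mathbf 1^{\mathrm T}$, let $D_p=\operatorname{diag}(1^p,\dots,n^p,1^p,\dots,n^p)$ with $p=2+\beta$, $0<\beta<1/2$, and let $PAD_p^{-1}=U_c\Sigma_cV_c^{\mathrm T}$ be a singular value decomposition with singular values $\sigma_{c,r}$ in nonincreasing order and singular vectors $\mathbf u_{c,r},\mathbf v_{c,r}$. The regularized coefficient vector is $$\mathbf z_J^\delta=D_p^{-1}\sum_{r=1}^{\nu}\frac{\langle P\mathbf g_J^\delta,\mathbf u_{c,r}\rangle}{\sigma_{c,r}}\mathbf v_{c,r},$$ where the truncation index $\nu$ is the smallest index with $\sigma_{c,\nu}\ge\epsilon_{\rm sv}\sigma_{c,1}$ for which the residual $\|a_{0}\mathbf 1+A\mathbf z-\mathbf g_J^\delta\|_2$ (with $\mathbf z$ the vector truncated at $\nu$ and $a_0=\frac1m\mathbf 1^{\mathrm T}(\mathbf g_J^\delta-A\mathbf z)$) is at most $\tau_{\rm det}$ times the local noise-norm estimate, or, if there is no such index, the largest index with $\sigma_{c,\nu}\ge\epsilon_{\rm sv}\sigma_{c,1}$; here $\epsilon_{\rm sv}>0$ and $\tau_{\rm det}>0$ are fixed. The vector $\mathbf z_J\in\mathbb R^{2n}$ is the exact (noise-free) coefficient vector in the same finite-dimensional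 space, regarded as a given vector. $\|\cdot\|_2$ is the Euclidean norm. *)

theory Defs
  imports
    "HOL-Probability.Essential_Supremum"
    "Jordan_Normal_Form.Matrix"
begin

no_notation Finite_Cartesian_Product.vec_nth (infixl \<open>$\<close> 90)
unbundle no inner_syntax

section \<open>Piecewise smooth sources and breakpoints\<close>

definition smooth :: "(real \<Rightarrow> real) \<Rightarrow> bool" where
  "smooth f \<longleftrightarrow> (\<forall>k x. (deriv ^^ k) f differentiable (at x))"

text \<open>Each branch is smooth up to the end points of its piece: it is the restriction of a function
  that is smooth on the whole line. Values at the finitely many partition points are irrelevant.\<close>

definition piecewise_smooth_on :: "real \<Rightarrow> real \<Rightarrow> (real \<Rightarrow> real) \<Rightarrow> bool" where
  "piecewise_smooth_on a b q \<longleftrightarrow>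
    (\<exists>B. finite B \<and> B \<subseteq> {a<..<b} \<and>
      (\<forall>c\<in>insert a (insert b B). \<forall>d\<in>insert a (insert b B).
        c < d \<and> {c<..<d} \<inter> B = {} \<longrightarrow>
        (\<exists>\<phi>. smooth \<phi> \<and> (\<forall>x\<in>{c<..<d}. q x = \<phi> x))))"

text \<open>The two branches do not continue each other smoothly, so that \<open>x\<close> really separates them.\<close>

definition breakpoint :: "(real \<Rightarrow> real) \<Rightarrow> real \<Rightarrow> bool" where
  "breakpoint q x \<longleftrightarrow> x \<in> {0<..<pi} \<and>
    (\<exists>\<phi>. smooth \<phi> \<and> (\<forall>\<^sub>F y in at_left x. q y = \<phi> y)) \<and>
    (\<exists>\<psi>. smooth \<psi> \<and> (\<forall>\<^sub>F y in at_right x. q y = \<psi> y)) \<and>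
    \<not> (\<exists>\<theta>. smooth \<theta> \<and> (\<forall>\<^sub>F y in at x. q y = \<theta> y))"

text \<open>The identity \<open>q = -g''\<close> on \<open>(0,\<pi>)\<close>. Nothing is required at a breakpoint, where \<open>g''\<close> need not
  exist.\<close>

definition neg_second_deriv :: "(real \<Rightarrow> real) \<Rightarrow> (real \<Rightarrow> real) \<Rightarrow> bool" where
  "neg_second_deriv g q \<longleftrightarrow>
    (\<forall>x\<in>{0<..<pi}. \<not> breakpoint q x \<longrightarrow>
      (\<forall>\<^sub>F y in nhds x. g differentiable (at y)) \<and>
      (deriv g has_real_derivative - q x) (at x))"

section \<open>The indicator\<close>

definition freq :: "real \<Rightarrow> real \<Rightarrow> real \<Rightarrow> real" where
  "freq T a b = 2 * pi / (T * (b - a))"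

definition tmap :: "real \<Rightarrow> real \<Rightarrow> real \<Rightarrow> real \<Rightarrow> real" where
  "tmap T a b x = freq T a b * (x - a)"

definition mollifier_scale :: "nat \<Rightarrow> real" where
  "mollifier_scale n = real n / sqrt (ln (real n))"

definition sigma_hat :: "real \<Rightarrow> nat \<Rightarrow> real" where
  "sigma_hat lam l = 1 / (sqrt pi * lam) * exp (- ((real l / lam)\<^sup>2))"

text \<open>A coefficient vector \<open>z = (a\<^sub>1,\<dots>,a\<^sub>n,b\<^sub>1,\<dots>,b\<^sub>n)\<close> is a vector of dimension \<open>2 n\<close>; vector indices
  start at 0, modes \<open>l\<close> at 1.\<close>

definition cos_coeff :: "real vec \<Rightarrow> nat \<Rightarrow> real" where
  "cos_coeff z l = z $ (l - 1)"

definition sin_coeff :: "nat \<Rightarrow> real vec \<Rightarrow> nat \<Rightarrow> real" where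
  "sin_coeff n z l = z $ (n + l - 1)"

definition cos_coeff_q :: "real \<Rightarrow> real vec \<Rightarrow> nat \<Rightarrow> real" where
  "cos_coeff_q \<mu> z l = (\<mu> * real l)\<^sup>2 * cos_coeff z l"

definition sin_coeff_q :: "real \<Rightarrow> nat \<Rightarrow> real vec \<Rightarrow> nat \<Rightarrow> real" where
  "sin_coeff_q \<mu> n z l = (\<mu> * real l)\<^sup>2 * sin_coeff n z l"

text \<open>The formula is used for all real \<open>x\<close>, so that derivatives at points of the interval \<open>[a,b]\<close> are
  ordinary two-sided derivatives (at an end point they equal the one-sided ones).\<close>

definition indicator_fn :: "real \<Rightarrow> real \<Rightarrow> real \<Rightarrow> nat \<Rightarrow> real vec \<Rightarrow> real \<Rightarrow> real" where
  "indicator_fn T a b n z x =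
    (\<Sum>l=1..n. real l * sigma_hat (mollifier_scale n) l *
      (sin_coeff_q (freq T a b) n z l * cos (real l * tmap T a b x)
       - cos_coeff_q (freq T a b) z l * sin (real l * tmap T a b x)))"

definition stability_const :: "real \<Rightarrow> real \<Rightarrow> real \<Rightarrow> nat \<Rightarrow> real" where
  "stability_const T a b n =
    freq T a b ^ 3 * sqrt (\<Sum>l=1..n. real l ^ 8 * (sigma_hat (mollifier_scale n) l)\<^sup>2)"

section \<open>The regularized coefficient vector\<close>

definition norm2 :: "real vec \<Rightarrow> real" where
  "norm2 v = sqrt (v \<bullet> v)"

text \<open>Arithmetic progression inside \<open>[a,b]\<close>; this covers nodes with or without the end points as well
  as midpoint nodes.\<close>

definition equispaced_nodes :: "real \<Rightarrow> real \<Rightarrow> nat \<Rightarrow> (nat \<Rightarrow> real) \<Rightarrow> bool" where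
  "equispaced_nodes a b m x \<longleftrightarrow>
    (\<exists>h>0. \<forall>r<m. x r = x 0 + real r * h \<and> x r \<in> {a..b})"

definition mode :: "nat \<Rightarrow> nat \<Rightarrow> nat" where
  "mode n j = (if j < n then j + 1 else j - n + 1)"

definition design_mat :: "nat \<Rightarrow> nat \<Rightarrow> (nat \<Rightarrow> real) \<Rightarrow> real mat" where
  "design_mat m n t = mat m (2 * n) (\<lambda>(r, j).
     if j < n then cos (real (mode n j) * t r) else sin (real (mode n j) * t r))"

definition centering_mat :: "nat \<Rightarrow> real mat" where
  "centering_mat m = 1\<^sub>m m - mat m m (\<lambda>_. 1 / real m)"

definition weight_mat :: "nat \<Rightarrow> real \<Rightarrow> real mat" where
  "weight_mat n p = mat_diag (2 * n) (\<lambda>j. real (mode n j) powr p)"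

text \<open>Hence \<open>D\<^sub>p\<inverse>\<close> is \<open>weight_mat n (-p)\<close>.\<close>

lemma weight_mat_inverse:
  "weight_mat n p * weight_mat n (- p) = 1\<^sub>m (2 * n)"
  "weight_mat n (- p) * weight_mat n p = 1\<^sub>m (2 * n)"
proof -
  have pos: "0 < real (mode n j)" for j
    by (simp add: mode_def)
  then have "real (mode n j) powr p * real (mode n j) powr (- p) = 1" for j
    by (simp add: powr_minus field_simps less_imp_neq[THEN not_sym])
  then show "weight_mat n p * weight_mat n (- p) = 1\<^sub>m (2 * n)"
    "weight_mat n (- p) * weight_mat n p = 1\<^sub>m (2 * n)"
    by (simp_all add: weight_mat_def mat_diag_diag mult.commute)
qed

text \<open>Full singular value decomposition \<open>M = U \<Sigma> V\<^sup>T\<close> with \<open>\<Sigma>\<close> rectangular diagonal.\<close>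

definition is_svd :: "real mat \<Rightarrow> real mat \<Rightarrow> real mat \<Rightarrow> real mat \<Rightarrow> bool" where
  "is_svd M U S V \<longleftrightarrow>
    U \<in> carrier_mat (dim_row M) (dim_row M) \<and>
    S \<in> carrier_mat (dim_row M) (dim_col M) \<and>
    V \<in> carrier_mat (dim_col M) (dim_col M) \<and>
    transpose_mat U * U = 1\<^sub>m (dim_row M) \<and>
    transpose_mat V * V = 1\<^sub>m (dim_col M) \<and>
    diagonal_mat S \<and>
    (\<forall>i < min (dim_row M) (dim_col M). 0 \<le> S $$ (i, i)) \<and>
    (\<forall>i j. i \<le> j \<and> j < min (dim_row M) (dim_col M) \<longrightarrow> S $$ (j, j) \<le> S $$ (i, i)) \<and>
    M = U * S * transpose_mat V"

text \<open>Singular values and vectors are numbered from 1, as is the truncation index below.\<close>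

definition sing_val :: "real mat \<Rightarrow> nat \<Rightarrow> real" where
  "sing_val S r = S $$ (r - 1, r - 1)"

definition truncated_coeffs ::
  "nat \<Rightarrow> nat \<Rightarrow> real \<Rightarrow> real mat \<Rightarrow> real mat \<Rightarrow> real mat \<Rightarrow> real vec \<Rightarrow> nat \<Rightarrow> real vec" where
  "truncated_coeffs m n p U S V gd \<nu> =
    weight_mat n (- p) *\<^sub>v
      vec (2 * n) (\<lambda>j. \<Sum>r=1..\<nu>.
        ((centering_mat m *\<^sub>v gd) \<bullet> col U (r - 1)) / sing_val S r * col V (r - 1) $ j)"

definition residual :: "nat \<Rightarrow> nat \<Rightarrow> (nat \<Rightarrow> real) \<Rightarrow> real vec \<Rightarrow> real vec \<Rightarrow> real" where
  "residual m n t gd z =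
    (let one = vec m (\<lambda>_. 1);
         a0 = 1 / real m * (one \<bullet> (gd - design_mat m n t *\<^sub>v z))
     in norm2 (a0 \<cdot>\<^sub>v one + design_mat m n t *\<^sub>v z - gd))"

text \<open>\<open>\<eta>\<close> is the local noise-norm estimate. For \<open>\<epsilon> \<le> 1\<close> the admissible set contains 1, so that the
  maximum in the second branch is taken over a nonempty set.\<close>

definition truncation_index ::
  "nat \<Rightarrow> nat \<Rightarrow> real \<Rightarrow> (nat \<Rightarrow> real) \<Rightarrow> real mat \<Rightarrow> real mat \<Rightarrow> real mat \<Rightarrow>
    real \<Rightarrow> real \<Rightarrow> real \<Rightarrow> real vec \<Rightarrow> nat" where
  "truncation_index m n p t U S V \<epsilon> \<tau> \<eta> gd =
    (let adm = {\<nu>\<in>{1..min m (2 * n)}. \<epsilon> * sing_val S 1 \<le> sing_val S \<nu>};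
         good = {\<nu>\<in>adm. residual m n t gd (truncated_coeffs m n p U S V gd \<nu>) \<le> \<tau> * \<eta>}
     in if good \<noteq> {} then Min good else Max adm)"

definition regularized_coeffs ::
  "nat \<Rightarrow> nat \<Rightarrow> real \<Rightarrow> (nat \<Rightarrow> real) \<Rightarrow> real mat \<Rightarrow> real mat \<Rightarrow> real mat \<Rightarrow>
    real \<Rightarrow> real \<Rightarrow> real \<Rightarrow> real vec \<Rightarrow> real vec" where
  "regularized_coeffs m n p t U S V \<epsilon> \<tau> \<eta> gd =
    truncated_coeffs m n p U S V gd (truncation_index m n p t U S V \<epsilon> \<tau> \<eta> gd)"

section \<open>Maximizers and the essential supremum norm\<close>

definition interior_local_maximizer :: "(real \<Rightarrow> real) \<Rightarrow> real set \<Rightarrow> real \<Rightarrow> bool" where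
  "interior_local_maximizer f U x \<longleftrightarrow> x \<in> interior U \<and> (\<forall>\<^sub>F y in at x within U. f y \<le> f x)"

text \<open>Extended-real valued, so that no finiteness is presupposed.\<close>

definition Linf_norm :: "real set \<Rightarrow> (real \<Rightarrow> real) \<Rightarrow> ereal" where
  "Linf_norm U f = esssup (lebesgue_on U) (\<lambda>x. ereal \<bar>f x\<bar>)"

end

theory Submission
  imports Defs
begin

text \<open>The indicator depends linearly on its coefficient vector, so the perturbation
  \<open>E = Cd - C\<close> is itself the indicator of \<open>zd - z\<close>.

  The bound for \<open>E'\<close> comes from differentiating termwise: mode \<open>l\<close> of \<open>E'\<close> has amplitude
  \<open>\<mu>\<^sup>3 l\<^sup>4 \<sigma>\<^sub>l\<close>, with \<open>\<sigma>\<^sub>l\<close> the mollifier weight, times the Euclidean length of the coefficient pair \<open>(a\<^sub>l, b\<^sub>l)\<close> of \<open>zd - z\<close>. One power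
  of \<open>l\<close> is the weight in the conjugate sum, two come from \<open>q = -g''\<close>, the fourth from the derivative.
  Cauchy--Schwarz over the modes separates the amplitudes from \<open>norm2 (zd - z)\<close>
  (lemma \<open>abs_deriv_indicator_fn_le\<close>).

  The bound for the maximizer is a mean value argument: at a maximizer \<open>\<xi>h\<close> of \<open>s Cd\<close> the derivative
  of \<open>s C\<close> equals \<open>-s E'(\<xi>h)\<close>, whereas it vanishes at \<open>\<xi>s\<close>, and on \<open>U\<close> it decreases at rate at least
  \<open>\<kappa>\<close> (lemma \<open>strong_monotone_displacement\<close>). Hence \<open>\<bar>\<xi>h - \<xi>s\<bar> \<le> \<bar>E'(\<xi>h)\<bar> / \<kappa>\<close>. This is a
  pointwise value, which the essential supremum dominates because \<open>E'\<close> is continuous and \<open>\<xi>h\<close> is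
  interior (lemma \<open>abs_le_Linf_norm\<close>). The triangle inequality then gives the distance to \<open>\<xi>\<close>.\<close>

section \<open>The derivative of the indicator\<close>

lemma indicator_fn_has_derivative:
  "(indicator_fn T a b n z has_real_derivative
     - (freq T a b ^ 3) * (\<Sum>l=1..n. real l ^ 4 * sigma_hat (mollifier_scale n) l *
        (cos_coeff z l * cos (real l * tmap T a b x) + sin_coeff n z l * sin (real l * tmap T a b x))))
   (at x)"
proof -
  define \<mu> where "\<mu> = freq T a b"
  define w where "w l = real l * sigma_hat (mollifier_scale n) l" for l
  have "(indicator_fn T a b n z has_real_derivative
      (\<Sum>l=1..n. w l * (sin_coeff_q \<mu> n z l * (- sin (real l * tmap T a b x) * (real l * \<mu>))
        - cos_coeff_q \<mu> z l * (cos (real l * tmap T a b x) * (real l * \<mu>))))) (at x)"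
    unfolding indicator_fn_def[abs_def] tmap_def \<mu>_def[symmetric] w_def[symmetric]
    by (intro DERIV_sum DERIV_cmult DERIV_diff) (rule derivative_eq_intros refl | simp)+
  also have "(\<Sum>l=1..n. w l * (sin_coeff_q \<mu> n z l * (- sin (real l * tmap T a b x) * (real l * \<mu>))
        - cos_coeff_q \<mu> z l * (cos (real l * tmap T a b x) * (real l * \<mu>))))
    = - (\<mu> ^ 3) * (\<Sum>l=1..n. real l ^ 4 * sigma_hat (mollifier_scale n) l *
        (cos_coeff z l * cos (real l * tmap T a b x) + sin_coeff n z l * sin (real l * tmap T a b x)))"
    unfolding sum_distrib_left
    by (intro sum.cong refl) (simp add: w_def cos_coeff_q_def sin_coeff_q_def algebra_simps
        power2_eq_square power3_eq_cube power4_eq_xxxx)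
  finally show ?thesis
    by (simp only: \<mu>_def)
qed

lemma deriv_indicator_fn:
  "deriv (indicator_fn T a b n z) =
     (\<lambda>x. - (freq T a b ^ 3) * (\<Sum>l=1..n. real l ^ 4 * sigma_hat (mollifier_scale n) l *
        (cos_coeff z l * cos (real l * tmap T a b x) + sin_coeff n z l * sin (real l * tmap T a b x))))"
  by (intro ext DERIV_imp_deriv indicator_fn_has_derivative)

lemma deriv_indicator_fn_differentiable:
  "deriv (indicator_fn T a b n z) differentiable (at x)"
proof -
  have "(\<lambda>y. cos (k * tmap T a b y)) differentiable (at x)"
    "(\<lambda>y. sin (k * tmap T a b y)) differentiable (at x)" for k
    unfolding tmap_def real_differentiable_def by (rule exI, (rule derivative_eq_intros refl)+)+
  then show ?thesis
    unfolding deriv_indicator_fn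
    by (intro differentiable_mult differentiable_sum differentiable_add differentiable_const) auto
qed

lemma indicator_fn_diff:
  assumes "z \<in> carrier_vec (2 * n)"
  shows "indicator_fn T a b n w y - indicator_fn T a b n z y = indicator_fn T a b n (w - z) y"
  using assms unfolding indicator_fn_def sum_subtractf[symmetric]
  by (intro sum.cong) (auto simp: cos_coeff_q_def sin_coeff_q_def cos_coeff_def sin_coeff_def algebra_simps)

text \<open>Pairing the cosine and sine coefficients of each mode puts the Euclidean norm into the form in
  which Cauchy--Schwarz over the modes produces it.\<close>

lemma norm2_split_modes:
  assumes "v \<in> carrier_vec (2 * n)"
  shows "norm2 v = sqrt (\<Sum>l=1..n. (cos_coeff v l)\<^sup>2 + (sin_coeff n v l)\<^sup>2)"
proof -
  have "v \<bullet> v = (\<Sum>i<n + n. (v $ i)\<^sup>2)"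
    using assms by (auto simp: scalar_prod_def power2_eq_square mult_2 atLeast0LessThan)
  also have "\<dots> = (\<Sum>i<n. (v $ i)\<^sup>2) + (\<Sum>i<n. (v $ (n + i))\<^sup>2)"
    by (simp add: sum.nat_group lessThan_atLeast0 sum.atLeastLessThan_concat[symmetric, of 0 n "n + n"]
        sum.shift_bounds_nat_ivl[of _ 0 n n, simplified] add.commute)
  also have "\<dots> = (\<Sum>l=1..n. (cos_coeff v l)\<^sup>2 + (sin_coeff n v l)\<^sup>2)"
    unfolding sum.distrib[symmetric]
    by (rule sum.reindex_bij_witness[of _ "\<lambda>l. l - 1" Suc]) (auto simp: cos_coeff_def sin_coeff_def)
  finally show ?thesis by (simp add: norm2_def)
qed

lemma abs_cos_sin_combination_le:
  fixes u v \<theta> :: real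
  shows "\<bar>u * cos \<theta> + v * sin \<theta>\<bar> \<le> sqrt (u\<^sup>2 + v\<^sup>2)"
proof (rule real_le_rsqrt)
  have "(u\<^sup>2 + v\<^sup>2) * (c\<^sup>2 + d\<^sup>2) = (u * c + v * d)\<^sup>2 + (u * d - v * c)\<^sup>2" for c d
    by (simp add: power2_eq_square algebra_simps)
  \<comment> \<open>Lagrange's identity on the unit circle; the second square is dropped\<close>
  from this[of "cos \<theta>" "sin \<theta>"]
  show "\<bar>u * cos \<theta> + v * sin \<theta>\<bar>\<^sup>2 \<le> u\<^sup>2 + v\<^sup>2"
    by simp
qed

text \<open>Each mode of the derivative is a sinusoid whose amplitude is at most the length of its
  coefficient pair; estimating modewise first and summing afterwards by Cauchy--Schwarz avoids the
  factor \<open>\<surd>2\<close> that treating the cosine and sine sums separately would cost.\<close>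

lemma abs_deriv_indicator_fn_le:
  assumes v: "v \<in> carrier_vec (2 * n)" and "0 \<le> freq T a b"
  shows "\<bar>deriv (indicator_fn T a b n v) y\<bar> \<le> stability_const T a b n * norm2 v"
proof -
  define w where "w l = real l ^ 4 * sigma_hat (mollifier_scale n) l" for l
  define c where "c l = cos_coeff v l * cos (real l * tmap T a b y)
    + sin_coeff n v l * sin (real l * tmap T a b y)" for l
  define r where "r l = sqrt ((cos_coeff v l)\<^sup>2 + (sin_coeff n v l)\<^sup>2)" for l
  have "\<bar>\<Sum>l=1..n. w l * c l\<bar> \<le> (\<Sum>l=1..n. \<bar>w l\<bar> * \<bar>c l\<bar>)"
    using sum_abs[of "\<lambda>l. w l * c l"] by (simp add: abs_mult)
  also have "\<dots> \<le> (\<Sum>l=1..n. \<bar>w l\<bar> * \<bar>r l\<bar>)"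
  proof (intro sum_mono mult_left_mono)
    show "\<bar>c l\<bar> \<le> \<bar>r l\<bar>" for l
      using abs_cos_sin_combination_le abs_ge_self unfolding c_def r_def by (rule order_trans)
  qed simp
  also have "\<dots> \<le> L2_set w {1..n} * L2_set r {1..n}"
    by (rule L2_set_mult_ineq)
  also have "L2_set r {1..n} = norm2 v"
    by (simp add: L2_set_def r_def norm2_split_modes[OF v])
  finally have "\<bar>\<Sum>l=1..n. w l * c l\<bar> \<le> L2_set w {1..n} * norm2 v" .
  then have "freq T a b ^ 3 * \<bar>\<Sum>l=1..n. w l * c l\<bar> \<le> freq T a b ^ 3 * (L2_set w {1..n} * norm2 v)"
    using assms by (intro mult_left_mono) auto
  then show ?thesis
    using assms by (simp add: deriv_indicator_fn abs_mult w_def c_def stability_const_def L2_set_def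
        power_mult_distrib mult.assoc flip: power_mult)
qed

section \<open>The essential supremum norm\<close>

lemma Linf_norm_le:
  assumes "U \<in> sets lebesgue" "continuous_on U f" "\<And>y. y \<in> U \<Longrightarrow> \<bar>f y\<bar> \<le> B"
  shows "Linf_norm U f \<le> ereal B"
  unfolding Linf_norm_def
proof (rule esssup_I)
  have "f \<in> borel_measurable (lebesgue_on U)"
    using assms by (intro continuous_imp_measurable_on_sets_lebesgue)
  then show "(\<lambda>x. ereal \<bar>f x\<bar>) \<in> borel_measurable (lebesgue_on U)"
    by measurable
qed (use assms in auto)

text \<open>An essential supremum ignores null sets, so it bounds a point value only through continuity: if
  \<open>\<bar>f x\<bar>\<close> exceeded it, so would \<open>\<bar>f\<bar>\<close> on a nonempty open subset of \<open>U\<close>, which is not null. Interiority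
  of \<open>x\<close> makes that subset a neighbourhood of \<open>x\<close>.\<close>

lemma abs_le_Linf_norm:
  assumes U: "U \<in> sets lebesgue" and f: "continuous_on (interior U) f" and x: "x \<in> interior U"
  shows "ereal \<bar>f x\<bar> \<le> Linf_norm U f"
proof (rule ccontr)
  assume "\<not> ?thesis"
  then obtain M where M: "Linf_norm U f < ereal M" "M < \<bar>f x\<bar>"
    by (metis ereal_dense2 less_ereal.simps(1) not_le)
  define V where "V = {y \<in> interior U. M < \<bar>f y\<bar>}"
  have "open V"
    using continuous_open_preimage[of "interior U" "\<lambda>y. \<bar>f y\<bar>" "{M<..}"] f
    by (simp add: V_def continuous_on_rabs vimage_def Int_def)
  moreover have "V \<in> null_sets lebesgue"
  proof -
    have "AE y in lebesgue_on U. ereal \<bar>f y\<bar> \<le> Linf_norm U f"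
      unfolding Linf_norm_def by (rule esssup_AE)
    then have "AE y in lebesgue_on U. y \<notin> V"
    proof eventually_elim
      case (elim y)
      then have "\<bar>f y\<bar> < M"
        using M(1) by (metis le_less_trans less_ereal.simps(1))
      then show ?case by (simp add: V_def)
    qed
    then have "AE y in lebesgue. y \<in> U \<longrightarrow> y \<notin> V"
      using U by (simp add: AE_restrict_space_iff)
    then have "AE y in lebesgue. y \<notin> V"
      by eventually_elim (use interior_subset in \<open>auto simp: V_def\<close>)
    then show ?thesis
      using \<open>open V\<close> by (subst AE_iff_null_sets) auto
  qed
  moreover have "x \<in> V"
    using x M by (simp add: V_def)
  ultimately show False
    using open_not_negligible[of V] by (auto simp: negligible_iff_null_sets)
qed

section \<open>Displacement of a maximizer\<close>

lemma interior_local_maximizer_deriv_eq_0: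
  assumes "interior_local_maximizer f U x" "f differentiable (at x)"
  shows "deriv f x = 0"
proof -
  have "\<forall>\<^sub>F y in at x. f y \<le> f x"
    using assms(1) at_within_interior[of x U] by (simp add: interior_local_maximizer_def)
  then obtain d where "d > 0" "\<And>y. y \<noteq> x \<Longrightarrow> dist y x < d \<Longrightarrow> f y \<le> f x"
    unfolding eventually_at by blast
  then have "\<forall>y. \<bar>x - y\<bar> < d \<longrightarrow> f y \<le> f x"
    by (metis abs_minus_commute dist_real_def order_refl)
  with \<open>d > 0\<close> assms(2) show ?thesis
    by (meson DERIV_local_max DERIV_deriv_iff_real_differentiable)
qed

text \<open>Applied with \<open>h\<close> the derivative of a strongly concave function and \<open>u\<close> its maximizer: by the
  mean value theorem \<open>h\<close> moves away from its zero at rate at least \<open>\<kappa>\<close>, so a small value of \<open>h\<close> at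
  \<open>v\<close> forces \<open>v\<close> to be near \<open>u\<close>.\<close>

lemma strong_monotone_displacement:
  fixes h :: "real \<Rightarrow> real"
  assumes U: "is_interval U" "u \<in> U" "v \<in> U"
    and diff: "\<And>y. y \<in> U \<Longrightarrow> h differentiable (at y)"
    and \<kappa>: "0 < \<kappa>" "\<And>y. y \<in> U \<Longrightarrow> \<kappa> \<le> - deriv h y"
    and "h u = 0"
  shows "\<bar>v - u\<bar> \<le> \<bar>h v\<bar> / \<kappa>"
proof -
  have *: "\<kappa> * (d - c) \<le> \<bar>h d - h c\<bar>" if cd: "c < d" "c \<in> U" "d \<in> U" for c d
  proof -
    have D: "(h has_real_derivative deriv h y) (at y)" if "c \<le> y" "y \<le> d" for y
      using diff that cd U(1) by (metis DERIV_deriv_iff_real_differentiable is_interval_1)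
    obtain y where y: "c < y" "y < d" "h d - h c = (d - c) * deriv h y"
      using MVT2[OF cd(1) D] by blast
    have "y \<in> U"
      using U(1) cd y unfolding is_interval_1 by (meson less_imp_le)
    then have "(d - c) * \<kappa> \<le> (d - c) * - deriv h y"
      using \<kappa> cd by (intro mult_left_mono) auto
    then show ?thesis
      using y(3) by (simp add: mult.commute)
  qed
  have "\<kappa> * \<bar>v - u\<bar> \<le> \<bar>h v - h u\<bar>"
    using *[of u v] *[of v u] U by (cases u v rule: linorder_cases) (simp_all add: abs_minus_commute)
  then show ?thesis
    using \<kappa>(1) \<open>h u = 0\<close> by (simp add: field_simps)
qed

section \<open>Stability of the detected breakpoint\<close>

theorem proposition3p2:
  fixes g q :: "real \<Rightarrow> real"
    and T a b :: real
    and n m :: nat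
    and \<beta> \<epsilon> \<tau> \<eta> :: real
    and x e :: "nat \<Rightarrow> real"
    and Uc Sc Vc :: "real mat"
    and gd z zd :: "real vec"
    and U :: "real set"
    and \<xi> \<xi>s s \<kappa> :: real
    and C Cd :: "real \<Rightarrow> real"
  assumes q: "neg_second_deriv g q" "piecewise_smooth_on 0 pi q"
    and T: "1 < T"
    and J: "a < b" "{a..b} \<subseteq> {0..pi}"
    and n: "2 \<le> n"
    and m: "1 \<le> m"
    and params: "0 < \<beta>" "\<beta> < 1/2" "0 < \<epsilon>" "0 < \<tau>" "0 \<le> \<eta>"
    and nodes: "equispaced_nodes a b m x"
    and samples: "gd = vec m (\<lambda>r. g (x r) + e r)"
    and svd: "is_svd (centering_mat m * design_mat m n (\<lambda>r. tmap T a b (x r))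
                        * weight_mat n (- (2 + \<beta>))) Uc Sc Vc"
    and zd: "zd = regularized_coeffs m n (2 + \<beta>) (\<lambda>r. tmap T a b (x r)) Uc Sc Vc \<epsilon> \<tau> \<eta> gd"
    and z: "z \<in> carrier_vec (2 * n)"
    and C: "C = indicator_fn T a b n z"
    and Cd: "Cd = indicator_fn T a b n zd"
    and U: "is_interval U" "U \<subseteq> {a..b}"
    and xi: "{y\<in>U. breakpoint q y} = {\<xi>}"
    and s: "s \<in> {-1, 1}"
    and xis: "interior_local_maximizer (\<lambda>y. s * C y) U \<xi>s"
    and crit: "deriv (\<lambda>y. s * C y) \<xi>s = 0"
    and kappa: "0 < \<kappa>"
    and concave: "\<And>y. y \<in> U \<Longrightarrow> \<kappa> \<le> - deriv (deriv (\<lambda>y. s * C y)) y"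
  shows "(\<forall>\<xi>h. interior_local_maximizer (\<lambda>y. s * Cd y) U \<xi>h \<longrightarrow>
            ereal \<bar>\<xi>h - \<xi>s\<bar> \<le> ereal (1 / \<kappa>) * Linf_norm U (deriv (\<lambda>y. Cd y - C y)))
       \<and> Linf_norm U (deriv (\<lambda>y. Cd y - C y)) \<le> ereal (stability_const T a b n * norm2 (zd - z))
       \<and> (\<forall>\<xi>h. interior_local_maximizer (\<lambda>y. s * Cd y) U \<xi>h \<longrightarrow>
            \<bar>\<xi>h - \<xi>\<bar> \<le> stability_const T a b n / \<kappa> * norm2 (zd - z) + \<bar>\<xi>s - \<xi>\<bar>)"
proof -
  define E where "E = indicator_fn T a b n (zd - z)"
  define h where "h = (\<lambda>y. s * deriv C y)"
  have zd_dim: "zd \<in> carrier_vec (2 * n)"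
    unfolding zd regularized_coeffs_def truncated_coeffs_def weight_mat_def
    by (intro mult_mat_vec_carrier[of _ _ "2 * n"]) simp_all
  have w: "zd - z \<in> carrier_vec (2 * n)"
    using zd_dim z by simp
  have freq: "0 \<le> freq T a b"
    using T J by (simp add: freq_def)
  have E: "(\<lambda>y. Cd y - C y) = E"
    by (simp add: E_def C Cd indicator_fn_diff[OF z] fun_eq_iff)
  have contE: "continuous_on A (deriv E)" for A
    unfolding E_def by (intro continuous_at_imp_continuous_on ballI differentiable_imp_continuous_within
        deriv_indicator_fn_differentiable)
  have Umeas: "U \<in> sets lebesgue"
    using U by (simp add: real_interval_borel_measurable)
  have DC: "(C has_real_derivative deriv C y) (at y)"
    and DCd: "(Cd has_real_derivative deriv Cd y) (at y)" for y
    unfolding C Cd DERIV_deriv_iff_has_field_derivative using indicator_fn_has_derivative by (rule exI)+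
  have dE: "deriv E y = deriv Cd y - deriv C y" for y
    unfolding E[symmetric] by (intro DERIV_imp_deriv derivative_intros DC DCd)
  have dsC: "deriv (\<lambda>y. s * C y) = h"
    unfolding h_def by (intro ext DERIV_imp_deriv DERIV_cmult DC)
  have hdiff: "h differentiable (at y)" for y
    unfolding h_def C by (intro derivative_intros deriv_indicator_fn_differentiable)
  have bound: "\<bar>deriv E y\<bar> \<le> stability_const T a b n * norm2 (zd - z)" for y
    unfolding E_def by (rule abs_deriv_indicator_fn_le[OF w freq])
  have disp: "\<bar>\<xi>h - \<xi>s\<bar> \<le> \<bar>deriv E \<xi>h\<bar> / \<kappa>" "\<xi>h \<in> interior U"
    if max: "interior_local_maximizer (\<lambda>y. s * Cd y) U \<xi>h" for \<xi>h
  proof -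
    show int: "\<xi>h \<in> interior U"
      using max by (simp add: interior_local_maximizer_def)
    have D: "((\<lambda>y. s * Cd y) has_real_derivative s * deriv Cd \<xi>h) (at \<xi>h)"
      by (intro DERIV_cmult DCd)
    have "s * deriv Cd \<xi>h = 0"
      using interior_local_maximizer_deriv_eq_0[OF max] D DERIV_imp_deriv[OF D]
      by (auto simp: real_differentiable_def)
    then have "deriv Cd \<xi>h = 0"
      using s by auto
    \<comment> \<open>stationarity of the perturbed indicator turns the slope of \<open>C\<close> at \<open>\<xi>h\<close> into \<open>- E'\<close>\<close>
    then have "\<bar>h \<xi>h\<bar> = \<bar>deriv E \<xi>h\<bar>"
      using s by (auto simp: h_def dE)
    moreover have "\<bar>\<xi>h - \<xi>s\<bar> \<le> \<bar>h \<xi>h\<bar> / \<kappa>"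
    proof (rule strong_monotone_displacement[OF U(1)])
      show "\<xi>s \<in> U" "\<xi>h \<in> U"
        using xis int interior_subset by (auto simp: interior_local_maximizer_def)
    qed (use hdiff kappa concave crit dsC in auto)
    ultimately show "\<bar>\<xi>h - \<xi>s\<bar> \<le> \<bar>deriv E \<xi>h\<bar> / \<kappa>" by simp
  qed
  have "ereal \<bar>\<xi>h - \<xi>s\<bar> \<le> ereal (1 / \<kappa>) * Linf_norm U (deriv E)"
    if max: "interior_local_maximizer (\<lambda>y. s * Cd y) U \<xi>h" for \<xi>h
  proof -
    have "ereal \<bar>\<xi>h - \<xi>s\<bar> \<le> ereal (1 / \<kappa>) * ereal \<bar>deriv E \<xi>h\<bar>"
      using disp(1)[OF max] by simp
    also have "\<dots> \<le> ereal (1 / \<kappa>) * Linf_norm U (deriv E)"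
      using kappa by (intro ereal_mult_left_mono abs_le_Linf_norm Umeas contE disp(2)[OF max]) auto
    finally show ?thesis .
  qed
  moreover have "Linf_norm U (deriv E) \<le> ereal (stability_const T a b n * norm2 (zd - z))"
    by (intro Linf_norm_le Umeas contE bound)
  moreover have "\<bar>\<xi>h - \<xi>\<bar> \<le> stability_const T a b n / \<kappa> * norm2 (zd - z) + \<bar>\<xi>s - \<xi>\<bar>"
    if max: "interior_local_maximizer (\<lambda>y. s * Cd y) U \<xi>h" for \<xi>h
  proof -
    have "\<bar>\<xi>h - \<xi>s\<bar> \<le> stability_const T a b n * norm2 (zd - z) / \<kappa>"
      using disp(1)[OF max] divide_right_mono[OF bound[of \<xi>h], of \<kappa>] kappa by linarith
    then show ?thesis by simp
  qed
  ultimately show ?thesis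
    unfolding E by blast
qed

end
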